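(* Let $P\in\mathbb{R}^{q\times n}$, $A\in\mathbb{R}^{m\times n}$, $b\in\mathbb{R}^m$, and let $S=\{x\in\mathbb{R}^n\mid Ax\ge b\}\neq\emptyset$. Let $f\colon\mathbb{R}^q\to\mathbb{R}$ be quasi-concave. Let $C=\{Y\lambda\mid\lambda\in\mathbb{R}^o_+\}=\{y\in\mathbb{R}^q\mid Z^{\top}y\ge 0\}$ be a polyhedral convex pointed cone with nonempty interior such that $f$ is $C$-monotone on $P[S]-C$ and $0^+P[S]\subseteq C$. Then the modified primal Benson-type algorithm described in the context (with input $A,b,P,Y,Z,f$, a point $c\in\operatorname{int}C$, and a polyhedron $\mathcal{O}$ with $\mathcal{O}\supseteq P[S]+C$ and $0^+\mathcal{O}=C$) is correct and finite: for any admissible choices made during its execution, all its steps can be carried out, it terminates after finitely many iterations, and the point $x$ it returns is an optimal solution of $$\min f(Px)\quad\text{s.t.}\quad Ax\ge b.$$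
   Context: Notation: $P[S]=\{Px\mid x\in S\}$; sums and differences of sets are Minkowski sums and differences; $0^+D$ is the recession cone of a nonempty polyhedron $D$. A cone $C$ is pointed if $C\cap(-C)=\{0\}$. $f$ is quasi-concave if all sets $\{y\mid f(y)\ge r\}$, $r\in\mathbb{R}$, are convex. $x\le_C y$ means $y-x\in C$; $f$ is $C$-monotone on $D$ if $x,y\in D$, $x\le_C y$ imply $f(x)\le f(y)$. Scalar problems: for $t\in\mathbb{R}^q$ consider the linear program $$(\mathrm{P}_2(t))\quad \min z\ \text{ over } (x,z)\in\mathbb{R}^n\times\mathbb{R}\ \text{ s.t. } Ax\ge b,\ Z^{\top}Px\le Z^{\top}t+z\,Z^{\top}c,$$ and its dual $$(\mathrm{D}_2(t))\quad \max\, b^{\top}u-t^{\top}w\ \text{ over }(u,w)\in\mathbb{R}^m\times\mathbb{R}^q\ \text{ s.t. } A^{\top}u=P^{\top}w,\ c^{\top}w=1,\ Y^{\top}w\ge 0,\ u\ge 0.$$ Algorithm: Compute the set $\mathcal{O}_{\rm poi}$ of vertices of $\mathcal{O}$. Then repeat the following loop: (1) choose any $t\in\mathcal{O}_{\rm poi}$ minimizing $f$ over $\mathcal{O}_{\rm poi}$; (2) compute any optimal solutions $(x,z)$ of $(\mathrm{P}_2(t))$ and $(u,w)$ of $(\mathrm{D}_2(t))$; (3) if $z>0$, replace $\mathcal{O}$ by $\mathcal{O}\cap\{y\in\mathbb{R}^q\mid w^{\top}y\ge b^{\top}u\}$, recompute the set $\mathcal{O}_{\rm poi}$ of vertices of $\mathcal{O}$,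 and continue the loop; otherwise stop and return $x$. *)

theory Defs
  imports "HOL-Analysis.Analysis"
begin

text \<open>
  Vectors and matrices are \<^typ>\<open>real^'n\<close> and \<^typ>\<open>real^'n^'m\<close> (\<open>m\<close> rows, \<open>n\<close> columns);
  \<open>\<le>\<close> on vectors is the componentwise order of the library.
\<close>

definition minkowski_diff :: "'a::ab_group_add set \<Rightarrow> 'a set \<Rightarrow> 'a set" where
  "minkowski_diff D E = {x - y | x y. x \<in> D \<and> y \<in> E}"

definition pointed :: "'a::real_vector set \<Rightarrow> bool" where
  "pointed C \<longleftrightarrow> C \<inter> uminus ` C = {0}"

definition recession_cone :: "'a::real_vector set \<Rightarrow> 'a set" where
  "recession_cone D = {d. \<forall>x\<in>D. \<forall>r\<ge>0. x + r *\<^sub>R d \<in> D}"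

definition quasi_concave :: "('a::real_vector \<Rightarrow> real) \<Rightarrow> bool" where
  "quasi_concave f \<longleftrightarrow> (\<forall>r. convex {y. f y \<ge> r})"

definition cone_monotone_on :: "'a::real_vector set \<Rightarrow> 'a set \<Rightarrow> ('a \<Rightarrow> real) \<Rightarrow> bool" where
  "cone_monotone_on D C f \<longleftrightarrow> (\<forall>x\<in>D. \<forall>y\<in>D. y - x \<in> C \<longrightarrow> f x \<le> f y)"

definition vertices :: "'a::real_vector set \<Rightarrow> 'a set" where
  "vertices D = {v. v extreme_point_of D}"

definition P2_feasible ::
  "real^'n^'m \<Rightarrow> real^'m \<Rightarrow> real^'n^'q \<Rightarrow> real^'p^'q \<Rightarrow> real^'q \<Rightarrow> real^'q
    \<Rightarrow> (real^'n) \<times> real \<Rightarrow> bool" where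
  "P2_feasible A b P Z c t = (\<lambda>(x, z).
     b \<le> A *v x \<and>
     transpose Z *v (P *v x) \<le> transpose Z *v t + z *\<^sub>R (transpose Z *v c))"

definition P2_optimal ::
  "real^'n^'m \<Rightarrow> real^'m \<Rightarrow> real^'n^'q \<Rightarrow> real^'p^'q \<Rightarrow> real^'q \<Rightarrow> real^'q
    \<Rightarrow> (real^'n) \<times> real \<Rightarrow> bool" where
  "P2_optimal A b P Z c t = is_arg_min (\<lambda>(x, z). z) (P2_feasible A b P Z c t)"

definition D2_feasible ::
  "real^'n^'m \<Rightarrow> real^'n^'q \<Rightarrow> real^'o^'q \<Rightarrow> real^'q
    \<Rightarrow> (real^'m) \<times> (real^'q) \<Rightarrow> bool" where
  "D2_feasible A P Y c = (\<lambda>(u, w).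
     transpose A *v u = transpose P *v w \<and> c \<bullet> w = 1 \<and>
     0 \<le> transpose Y *v w \<and> 0 \<le> u)"

definition D2_optimal ::
  "real^'n^'m \<Rightarrow> real^'m \<Rightarrow> real^'n^'q \<Rightarrow> real^'o^'q \<Rightarrow> real^'q \<Rightarrow> real^'q
    \<Rightarrow> (real^'m) \<times> (real^'q) \<Rightarrow> bool" where
  "D2_optimal A b P Y c t =
     is_arg_max (\<lambda>(u, w). b \<bullet> u - t \<bullet> w) (D2_feasible A P Y c)"

text \<open>
  The algorithm is a nondeterministic transition system. A running state carries the current
  outer approximation; its vertex set is determined by it and hence not stored separately. One
  transition is one pass through the loop, for arbitrary admissible choices of \<open>t\<close>,
  \<open>(x, z)\<close> and \<open>(u, w)\<close>.
\<close>

datatype ('s, 'r) state = Running 's | Returned 'r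

definition selectable :: "('a::real_vector \<Rightarrow> real) \<Rightarrow> 'a set \<Rightarrow> 'a \<Rightarrow> bool" where
  "selectable f D = is_arg_min f (\<lambda>t. t \<in> vertices D)"

inductive benson_step ::
  "real^'n^'m \<Rightarrow> real^'m \<Rightarrow> real^'n^'q \<Rightarrow> real^'o^'q \<Rightarrow> real^'p^'q \<Rightarrow> (real^'q \<Rightarrow> real) \<Rightarrow> real^'q
    \<Rightarrow> ((real^'q) set, real^'n) state \<Rightarrow> ((real^'q) set, real^'n) state \<Rightarrow> bool"
  for A b P Y Z f c
where
  cut: "\<lbrakk> selectable f D t; P2_optimal A b P Z c t (x, z); D2_optimal A b P Y c t (u, w); z > 0 \<rbrakk>
    \<Longrightarrow> benson_step A b P Y Z f c (Running D) (Running (D \<inter> {y. w \<bullet> y \<ge> b \<bullet> u}))"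
| stop: "\<lbrakk> selectable f D t; P2_optimal A b P Z c t (x, z); D2_optimal A b P Y c t (u, w); \<not> z > 0 \<rbrakk>
    \<Longrightarrow> benson_step A b P Y Z f c (Running D) (Returned x)"

text \<open>
  The two linear programs have to be solvable for every admissible choice of \<open>t\<close>, since the
  choice is made before they are solved.
\<close>

definition benson_executable ::
  "real^'n^'m \<Rightarrow> real^'m \<Rightarrow> real^'n^'q \<Rightarrow> real^'o^'q \<Rightarrow> real^'p^'q \<Rightarrow> (real^'q \<Rightarrow> real) \<Rightarrow> real^'q
    \<Rightarrow> (real^'q) set \<Rightarrow> bool" where
  "benson_executable A b P Y Z f c D \<longleftrightarrow>
     polyhedron D \<and> finite (vertices D) \<and> (\<exists>t. selectable f D t) \<and>
     (\<forall>t. selectable f D t \<longrightarrow>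
        (\<exists>x z. P2_optimal A b P Z c t (x, z)) \<and> (\<exists>u w. D2_optimal A b P Y c t (u, w)))"

end

theory Submission
  imports Defs
begin

text \<open>
  LP duality makes every cut \<open>w \<bullet> y \<ge> b \<bullet> u\<close> valid for the upper image \<open>P[S] + C\<close> and makes it
  hold with equality at \<open>t + z *\<^sub>R c\<close>, so each cut supports the upper image in a face that no
  earlier cut has; hence only finitely many cuts occur. The dual is feasible because \<open>c\<close> lies in
  the interior of the pointed cone \<open>C\<close>, which contains the recession cone of \<open>P[S]\<close>.

  If \<open>z \<le> 0\<close>, then \<open>t \<in> P x + C\<close>; as \<open>t\<close> is a vertex of a set containing \<open>P x + C\<close>, even
  \<open>t = P x\<close>. Any other image point \<open>P x'\<close> is \<open>v + k\<close> with \<open>v\<close> a convex combination of vertices and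
  \<open>k \<in> C\<close>, so \<open>f (P x') \<ge> f v \<ge> f t\<close> by monotonicity and quasi-concavity.
\<close>

section \<open>Linear programming duality\<close>

text \<open>A finitely generated cone is closed, so a \<open>g\<close> outside it would be strictly
  separated from it. Scaling invariance turns the separating vector into one that violates
  \<open>valid\<close>.\<close>

lemma farkas_cone:
  fixes a :: "'i \<Rightarrow> 'a::euclidean_space"
  assumes "finite I"
    and valid: "\<And>x. (\<And>i. i \<in> I \<Longrightarrow> a i \<bullet> x \<ge> 0) \<Longrightarrow> g \<bullet> x \<ge> 0"
  obtains u where "\<And>i. u i \<ge> 0" "(\<Sum>i\<in>I. u i *\<^sub>R a i) = g"
proof -
  define K where "K = convex_cone hull (a ` I)"
  define R where "R = {y. \<exists>u. (\<forall>i. u i \<ge> 0) \<and> (\<Sum>i\<in>I. u i *\<^sub>R a i) = y}"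
  have K: "convex_cone K" "closed K"
    unfolding K_def using assms(1) by (auto intro: convex_cone_convex_cone_hull closed_convex_cone_hull)
  have "convex_cone R"
    unfolding convex_cone_iff
  proof (intro conjI ballI allI impI)
    show "0 \<in> R" unfolding R_def by (auto intro!: exI[of _ "\<lambda>_. 0"])
    fix x assume "x \<in> R"
    then obtain u where u: "\<forall>i. u i \<ge> 0" "(\<Sum>i\<in>I. u i *\<^sub>R a i) = x" unfolding R_def by auto
    show "r *\<^sub>R x \<in> R" if "r \<ge> 0" for r
      unfolding R_def using u that by (auto intro!: exI[of _ "\<lambda>i. r * u i"] simp: scaleR_sum_right)
    fix y assume "y \<in> R"
    then obtain v where v: "\<forall>i. v i \<ge> 0" "(\<Sum>i\<in>I. v i *\<^sub>R a i) = y" unfolding R_def by auto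
    show "x + y \<in> R"
      unfolding R_def using u v
      by (auto intro!: exI[of _ "\<lambda>i. u i + v i"] simp: sum.distrib scaleR_left_distrib)
  qed
  moreover have "a ` I \<subseteq> R"
  proof
    fix y assume "y \<in> a ` I"
    then obtain j where j: "j \<in> I" "y = a j" by auto
    have "(\<Sum>i\<in>I. (if i = j then 1 else 0) *\<^sub>R a i) = (\<Sum>i\<in>I. if i = j then a i else 0)"
      by (rule sum.cong) auto
    then show "y \<in> R"
      unfolding R_def using j assms(1) by (auto intro!: exI[of _ "\<lambda>i. if i = j then 1 else 0"])
  qed
  ultimately have "K \<subseteq> R" unfolding K_def by (simp add: hull_minimal)
  moreover have "g \<in> K"
  proof (rule ccontr)
    assume "g \<notin> K"
    then obtain x e where x: "x \<bullet> g < e" "\<forall>y\<in>K. x \<bullet> y > e"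
      using separating_hyperplane_closed_point[of K g] K by (auto simp: convex_cone_def)
    have "e < 0" using x(2) K(1) convex_cone_contains_0 by fastforce
    have "x \<bullet> y \<ge> 0" if "y \<in> K" for y
    proof (rule ccontr)
      assume neg: "\<not> x \<bullet> y \<ge> 0"
      \<comment> \<open>The factor is positive and moves \<open>y\<close> onto the hyperplane of
        value exactly \<open>e\<close>, which contradicts the strict separation.\<close>
      have "(e / (x \<bullet> y)) *\<^sub>R y \<in> K"
        using K(1) that neg \<open>e < 0\<close> by (simp add: convex_cone_iff divide_nonpos_neg)
      with x(2) have "x \<bullet> ((e / (x \<bullet> y)) *\<^sub>R y) > e" by blast
      with neg show False by simp
    qed
    moreover have "a i \<in> K" if "i \<in> I" for i unfolding K_def using that by (simp add: hull_inc)
    ultimately have "g \<bullet> x \<ge> 0" by (intro valid) (subst inner_commute, blast)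
    with x(1) \<open>e < 0\<close> show False by (simp add: inner_commute)
  qed
  ultimately show ?thesis using that unfolding R_def by blast
qed

text \<open>Homogenization: the vectors \<open>(a i, \<beta> i)\<close> and the target
  \<open>(0, 1)\<close> go into \<open>farkas_cone\<close>. A violating pair \<open>(x, s)\<close>
  has \<open>s < 0\<close>, and dividing \<open>x\<close> by \<open>- s\<close> would solve the
  system.\<close>

lemma farkas_infeasible:
  fixes a :: "'i \<Rightarrow> 'a::euclidean_space"
  assumes "finite I" and "\<nexists>x. \<forall>i\<in>I. a i \<bullet> x \<ge> \<beta> i"
  obtains u where "\<And>i. u i \<ge> 0" "(\<Sum>i\<in>I. u i *\<^sub>R a i) = 0" "(\<Sum>i\<in>I. u i * \<beta> i) = 1"
proof -
  have nonneg: "(0::'a, 1::real) \<bullet> p \<ge> 0" if p: "\<And>i. i \<in> I \<Longrightarrow> (a i, \<beta> i) \<bullet> p \<ge> 0" for p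
  proof (rule ccontr)
    obtain x s where [simp]: "p = (x, s)" by fastforce
    assume "\<not> ?thesis"
    then have s: "s < 0" by simp
    have "a i \<bullet> ((- 1 / s) *\<^sub>R x) \<ge> \<beta> i" if "i \<in> I" for i
      using p[OF that] s by (simp add: field_simps)
    with assms(2) show False by blast
  qed
  show ?thesis
  proof (rule farkas_cone[of I "\<lambda>i. (a i, \<beta> i)" "(0, 1)"])
    fix u :: "'i \<Rightarrow> real"
    assume "\<And>i. u i \<ge> 0" "(\<Sum>i\<in>I. u i *\<^sub>R (a i, \<beta> i)) = (0, 1)"
    then show ?thesis by (intro that[of u]) (simp_all add: prod_eq_iff fst_sum snd_sum)
  qed (use assms(1) nonneg in auto)
qed

text \<open>Boundedness is stated through recession directions, because this form feeds
  \<open>farkas_cone\<close> directly and yields a dual feasible \<open>u0\<close>. The primal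
  infimum \<open>\<delta>\<close> is then finite, and two further uses of Farkas show that it is
  attained on both sides.\<close>

lemma lp_strong_duality:
  fixes a :: "'i \<Rightarrow> 'a::euclidean_space"
  assumes fin: "finite I" and feas: "\<forall>i\<in>I. a i \<bullet> x0 \<ge> \<beta> i"
    and bounded: "\<And>d. (\<And>i. i \<in> I \<Longrightarrow> a i \<bullet> d \<ge> 0) \<Longrightarrow> g \<bullet> d \<ge> 0"
  obtains x u where "\<forall>i\<in>I. a i \<bullet> x \<ge> \<beta> i" "\<forall>i. u i \<ge> 0"
    "(\<Sum>i\<in>I. u i *\<^sub>R a i) = g" "g \<bullet> x = (\<Sum>i\<in>I. u i * \<beta> i)"
proof -
  define V where "V = (\<lambda>x. g \<bullet> x) ` {x. \<forall>i\<in>I. a i \<bullet> x \<ge> \<beta> i}"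
  define \<delta> where "\<delta> = Inf V"
  have weak: "g \<bullet> x \<ge> (\<Sum>i\<in>I. u i * \<beta> i)"
    if "\<forall>i\<in>I. a i \<bullet> x \<ge> \<beta> i" "\<And>i. u i \<ge> 0" "(\<Sum>i\<in>I. u i *\<^sub>R a i) = g" for x u
  proof -
    have "(\<Sum>i\<in>I. u i * \<beta> i) \<le> (\<Sum>i\<in>I. u i * (a i \<bullet> x))"
      using that by (intro sum_mono mult_left_mono) auto
    also have "\<dots> = g \<bullet> x" by (simp add: inner_sum_left flip: that(3))
    finally show ?thesis .
  qed
  obtain u0 where u0: "\<And>i. u0 i \<ge> 0" "(\<Sum>i\<in>I. u0 i *\<^sub>R a i) = g"
    using farkas_cone[OF fin bounded] by blast
  have "V \<noteq> {}" using feas unfolding V_def by blast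
  have "bdd_below V" unfolding V_def using weak[OF _ u0] by (auto intro!: bdd_belowI)
  have \<delta>_le: "\<delta> \<le> g \<bullet> x" if "\<forall>i\<in>I. a i \<bullet> x \<ge> \<beta> i" for x
    unfolding \<delta>_def using \<open>bdd_below V\<close> that by (intro cInf_lower) (auto simp: V_def)
  have le_\<delta>: "(\<Sum>i\<in>I. u i * \<beta> i) \<le> \<delta>"
    if "\<And>i. u i \<ge> 0" "(\<Sum>i\<in>I. u i *\<^sub>R a i) = g" for u
    unfolding \<delta>_def using \<open>V \<noteq> {}\<close> weak[OF _ that] by (intro cInf_greatest) (auto simp: V_def)
  have "\<exists>x. (\<forall>i\<in>I. a i \<bullet> x \<ge> \<beta> i) \<and> g \<bullet> x \<le> \<delta>"
  proof (rule ccontr)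
    assume neg: "\<not> ?thesis"
    \<comment> \<open>The index \<open>None\<close> carries the added constraint
      \<open>g \<bullet> x \<le> \<delta>\<close>, with multiplier \<open>s\<close> in the
      certificate of infeasibility. If \<open>s = 0\<close>, the certificate refutes the feasible
      point \<open>x0\<close>; if \<open>s > 0\<close>, dividing by \<open>s\<close> gives a dual
      solution of value \<open>\<delta> + 1 / s\<close>, above the infimum.\<close>
    let ?J = "insert None (Some ` I)"
    let ?a = "case_option (- g) a" and ?\<beta> = "case_option (- \<delta>) \<beta>"
    have sum_J: "(\<Sum>j\<in>?J. h j) = h None + (\<Sum>i\<in>I. h (Some i))" for h :: "'i option \<Rightarrow> 'b::comm_monoid_add"
      using fin by (simp add: sum.reindex)
    have "\<nexists>x. \<forall>j\<in>?J. ?a j \<bullet> x \<ge> ?\<beta> j" using neg by auto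
    then obtain v where v: "\<And>j. v j \<ge> 0" "(\<Sum>j\<in>?J. v j *\<^sub>R ?a j) = 0" "(\<Sum>j\<in>?J. v j * ?\<beta> j) = 1"
      using farkas_infeasible[of ?J ?\<beta> ?a] fin by blast
    define s where "s = v None"
    have va: "(\<Sum>i\<in>I. v (Some i) *\<^sub>R a i) = s *\<^sub>R g"
      and vb: "(\<Sum>i\<in>I. v (Some i) * \<beta> i) = 1 + s * \<delta>"
      using v(2,3) unfolding sum_J s_def by (simp_all add: algebra_simps)
    show False
    proof (cases "s = 0")
      case True
      have "1 \<le> (\<Sum>i\<in>I. v (Some i) * (a i \<bullet> x0))"
        using vb True feas v(1) by (subst vb[unfolded True, simplified, symmetric]) (intro sum_mono mult_left_mono, auto)
      also have "\<dots> = (\<Sum>i\<in>I. v (Some i) *\<^sub>R a i) \<bullet> x0" by (simp add: inner_sum_left)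
      finally show False using va True by simp
    next
      case False
      with v(1)[of None] have s: "s > 0" by (simp add: s_def order_less_le)
      have "(\<Sum>i\<in>I. (v (Some i) / s) * \<beta> i) \<le> \<delta>"
      proof (rule le_\<delta>)
        show "v (Some i) / s \<ge> 0" for i using v(1) s by simp
        have "(\<Sum>i\<in>I. (v (Some i) / s) *\<^sub>R a i) = (1 / s) *\<^sub>R (\<Sum>i\<in>I. v (Some i) *\<^sub>R a i)"
          by (simp add: scaleR_sum_right)
        then show "(\<Sum>i\<in>I. (v (Some i) / s) *\<^sub>R a i) = g" using va s by simp
      qed
      moreover have "(\<Sum>i\<in>I. (v (Some i) / s) * \<beta> i) = (1 + s * \<delta>) / s"
        unfolding vb[symmetric] by (simp add: sum_divide_distrib)
      ultimately have "1 + s * \<delta> \<le> s * \<delta>" using s by (simp add: pos_divide_le_eq mult.commute)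
      then show False by simp
    qed
  qed
  then obtain x where x: "\<forall>i\<in>I. a i \<bullet> x \<ge> \<beta> i" "g \<bullet> x \<le> \<delta>" by blast
  \<comment> \<open>Dual attainment by homogenization. The extra generator \<open>(0, - 1)\<close>
    forces \<open>s \<le> 0\<close>: for \<open>s = 0\<close> the vector \<open>d\<close> is a
    recession direction, for \<open>s < 0\<close> it rescales to a feasible point.\<close>
  have "(g, \<delta>) \<bullet> p \<ge> 0"
    if p: "\<And>j. j \<in> insert None (Some ` I) \<Longrightarrow> case_option (0, - 1) (\<lambda>i. (a i, \<beta> i)) j \<bullet> p \<ge> 0" for p
  proof -
    obtain d s where [simp]: "p = (d, s)" by fastforce
    have s: "s \<le> 0" using p[of None] by simp
    have d: "a i \<bullet> d + \<beta> i * s \<ge> 0" if "i \<in> I" for i using p[of "Some i"] that by simp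
    show ?thesis
    proof (cases "s = 0")
      case True
      with d bounded show ?thesis by simp
    next
      case False
      with s have s: "s < 0" by simp
      have "\<delta> \<le> g \<bullet> ((- 1 / s) *\<^sub>R d)"
      proof (rule \<delta>_le, rule ballI)
        show "\<beta> i \<le> a i \<bullet> ((- 1 / s) *\<^sub>R d)" if "i \<in> I" for i
          using d[OF that] s by (simp add: field_simps)
      qed
      then show ?thesis using s by (simp add: field_simps)
    qed
  qed
  moreover have "finite (insert None (Some ` I))" using fin by simp
  ultimately obtain v where v: "\<And>j. v j \<ge> (0::real)"
    "(\<Sum>j\<in>insert None (Some ` I). v j *\<^sub>R case_option (0, - 1) (\<lambda>i. (a i, \<beta> i)) j) = (g, \<delta>)"
    using farkas_cone[of "insert None (Some ` I)" "case_option (0, - 1) (\<lambda>i. (a i, \<beta> i))" "(g, \<delta>)"] by blast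
  then have eq: "(\<Sum>i\<in>I. v (Some i) *\<^sub>R a i) = g" "(\<Sum>i\<in>I. v (Some i) * \<beta> i) = \<delta> + v None"
    using fin by (auto simp: sum.reindex prod_eq_iff fst_sum snd_sum)
  \<comment> \<open>The multiplier of \<open>(0, - 1)\<close> is the amount by which the dual value
    would exceed \<open>\<delta>\<close>; weak duality forces it to vanish.\<close>
  have "v None = 0" using le_\<delta>[OF v(1) eq(1)] eq(2) v(1)[of None] by linarith
  moreover have "g \<bullet> x = \<delta>" using x \<delta>_le[of x] by linarith
  ultimately show ?thesis using that[of x "\<lambda>i. v (Some i)"] x(1) v(1) eq by auto
qed

section \<open>Vertices and recession cones of polyhedra\<close>

lemma polyhedron_halfspace_representation:
  fixes D :: "'a::euclidean_space set"
  assumes "polyhedron D"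
  obtains F :: "'a set set" and a \<beta>
    where "finite F" "D = {x. \<forall>h\<in>F. a h \<bullet> x \<le> \<beta> h}"
proof -
  obtain F where F: "finite F" "D = \<Inter> F" "\<forall>h\<in>F. \<exists>a b. a \<noteq> 0 \<and> h = {x. a \<bullet> x \<le> b}"
    using assms unfolding polyhedron_def by blast
  have "\<forall>h\<in>F. \<exists>p. \<forall>x. x \<in> h \<longleftrightarrow> fst p \<bullet> x \<le> snd p"
    using F(3) by fastforce
  then obtain p where p: "\<forall>h\<in>F. \<forall>x. x \<in> h \<longleftrightarrow> fst (p h) \<bullet> x \<le> snd (p h)"
    unfolding bchoice_iff by blast
  have "D = {x. \<forall>h\<in>F. fst (p h) \<bullet> x \<le> snd (p h)}"
    unfolding F(2) using p by auto
  with F(1) show ?thesis by (rule that)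
qed

lemma convex_cone_recession_cone: "convex_cone (recession_cone D)"
  unfolding convex_cone_iff
proof (intro conjI ballI allI impI)
  show "0 \<in> recession_cone D" by (simp add: recession_cone_def)
  fix d assume d: "d \<in> recession_cone D"
  show "s *\<^sub>R d \<in> recession_cone D" if "s \<ge> 0" for s
    unfolding recession_cone_def
  proof (intro CollectI ballI allI impI)
    fix x and r :: real assume "x \<in> D" "r \<ge> 0"
    then have "x + (r * s) *\<^sub>R d \<in> D" using d that by (simp add: recession_cone_def)
    then show "x + r *\<^sub>R (s *\<^sub>R d) \<in> D" by simp
  qed
  fix d' assume d': "d' \<in> recession_cone D"
  show "d + d' \<in> recession_cone D"
    unfolding recession_cone_def
  proof (intro CollectI ballI allI impI)
    fix x and r :: real assume "x \<in> D" "r \<ge> 0"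
    then have "x + r *\<^sub>R d \<in> D" using d by (simp add: recession_cone_def)
    then have "(x + r *\<^sub>R d) + r *\<^sub>R d' \<in> D" using d' \<open>r \<ge> 0\<close> by (simp add: recession_cone_def)
    then show "x + r *\<^sub>R (d + d') \<in> D" by (simp add: algebra_simps)
  qed
qed

lemma inner_nonpos_if_ray_bounded:
  fixes a :: "'a::real_inner"
  assumes "\<And>r. r \<ge> 0 \<Longrightarrow> a \<bullet> (x + r *\<^sub>R d) \<le> \<beta>"
  shows "a \<bullet> d \<le> 0"
proof (rule ccontr)
  assume "\<not> ?thesis"
  then have pos: "a \<bullet> d > 0" by simp
  have "a \<bullet> x \<le> \<beta>" using assms[of 0] by simp
  \<comment> \<open>At this step length the value is \<open>\<beta> + a \<bullet> d\<close>; the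
    summand 1 produces the overshoot.\<close>
  then have "a \<bullet> (x + ((\<beta> - a \<bullet> x) / (a \<bullet> d) + 1) *\<^sub>R d) \<le> \<beta>" using pos by (intro assms) simp
  with pos show False by (simp add: inner_add_right distrib_right)
qed

lemma mem_recession_cone_halfspaces:
  fixes d :: "'a::real_inner"
  assumes "\<And>h. h \<in> F \<Longrightarrow> a h \<bullet> d \<le> 0"
  shows "d \<in> recession_cone {x. \<forall>h\<in>F. a h \<bullet> x \<le> \<beta> h}"
  unfolding recession_cone_def
proof (intro CollectI ballI allI impI)
  fix x and r :: real and h
  assume "x \<in> {x. \<forall>h\<in>F. a h \<bullet> x \<le> \<beta> h}" "r \<ge> 0" "h \<in> F"
  then have "a h \<bullet> x \<le> \<beta> h" "r * (a h \<bullet> d) \<le> 0"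
    using assms by (auto intro: mult_nonneg_nonpos)
  then show "a h \<bullet> (x + r *\<^sub>R d) \<le> \<beta> h" by (simp add: inner_add_right)
qed

text \<open>A single ray inside forces \<open>a h \<bullet> d \<le> 0\<close> for every constraint,
  a condition that no longer mentions the base point.\<close>

lemma polyhedron_ray_imp_recession_cone:
  fixes D :: "'a::euclidean_space set"
  assumes "polyhedron D" and ray: "\<And>r. r \<ge> 0 \<Longrightarrow> x + r *\<^sub>R d \<in> D"
  shows "d \<in> recession_cone D"
proof -
  obtain F and a :: "'a set \<Rightarrow> 'a" and \<beta>
    where "finite F" and D: "D = {x. \<forall>h\<in>F. a h \<bullet> x \<le> \<beta> h}"
    by (rule polyhedron_halfspace_representation[OF assms(1)])
  have "a h \<bullet> d \<le> 0" if "h \<in> F" for h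
    using ray that unfolding D by (intro inner_nonpos_if_ray_bounded[of _ x _ "\<beta> h"]) auto
  then show ?thesis unfolding D by (rule mem_recession_cone_halfspaces)
qed

text \<open>Ensures that a cut creates no new recession directions. Nonemptiness matters: by
  definition the recession cone of the empty set is the whole space.\<close>

lemma recession_cone_Int_subset:
  fixes D :: "'a::euclidean_space set"
  assumes "polyhedron D" and "D \<inter> H \<noteq> {}"
  shows "recession_cone (D \<inter> H) \<subseteq> recession_cone D"
proof
  fix d assume d: "d \<in> recession_cone (D \<inter> H)"
  obtain x where "x \<in> D \<inter> H" using assms(2) by blast
  with d have "x + r *\<^sub>R d \<in> D" if "r \<ge> 0" for r
    using that unfolding recession_cone_def by blast
  then show "d \<in> recession_cone D" by (rule polyhedron_ray_imp_recession_cone[OF assms(1)])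
qed

text \<open>
  A point that is not a vertex lies inside a segment of the polyhedron along which all
  active constraints stay active; moving along its line, in both directions, either activates a
  further constraint or never leaves the polyhedron. Hence the induction on the number of
  inactive constraints.
\<close>

proposition polyhedron_subset_vertices_plus_recession_cone:
  fixes D :: "'a::euclidean_space set"
  assumes "polyhedron D" and pointed: "pointed (recession_cone D)"
  shows "D \<subseteq> convex hull (vertices D) + recession_cone D"
proof -
  obtain F and a :: "'a set \<Rightarrow> 'a" and \<beta>
    where F: "finite F" and D: "D = {x. \<forall>h\<in>F. a h \<bullet> x \<le> \<beta> h}"
    by (rule polyhedron_halfspace_representation[OF assms(1)])
  define G where "G = convex hull (vertices D) + recession_cone D"
  note rc = convex_cone_recession_cone[of D, unfolded convex_cone_iff]
  have "convex G"
    unfolding G_def using convex_cone_recession_cone[of D]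
    by (intro convex_set_plus) (auto simp: convex_cone_def)
  have G_add: "y + k \<in> G" if "y \<in> G" "k \<in> recession_cone D" for y k
  proof -
    obtain v k' where "y = v + k'" "v \<in> convex hull (vertices D)" "k' \<in> recession_cone D"
      using \<open>y \<in> G\<close> unfolding G_def by (elim set_plus_elim)
    then have "v + (k' + k) \<in> G" using rc that(2) unfolding G_def by (intro set_plus_intro) auto
    then show ?thesis using \<open>y = v + k'\<close> by (simp add: add.assoc)
  qed
  define inactive where "inactive = (\<lambda>y. {h \<in> F. a h \<bullet> y < \<beta> h})"
  have "y \<in> G" if "y \<in> D" for y
    using that
  proof (induction "card (inactive y)" arbitrary: y rule: less_induct)
    case less
    show ?case
    proof (cases "y extreme_point_of D")
      case True
      then have "y \<in> convex hull (vertices D)" by (simp add: vertices_def hull_inc)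
      then have "y + 0 \<in> G" using rc unfolding G_def by (intro set_plus_intro) auto
      then show ?thesis by simp
    next
      case False
      then obtain p q where pq: "p \<in> D" "q \<in> D" "y \<in> open_segment p q"
        using less.prems unfolding extreme_point_of_def by blast
      define d where "d = q - p"
      obtain l where l: "0 < l" "l < 1" "y = (1 - l) *\<^sub>R p + l *\<^sub>R q" and "p \<noteq> q"
        using pq(3) by (auto simp: in_segment)
      have "d \<noteq> 0" using \<open>p \<noteq> q\<close> by (simp add: d_def)
      \<comment> \<open>The slacks at \<open>p\<close> and \<open>q\<close> are nonnegative and have
        a weighted sum of zero, so both vanish.\<close>
      have active: "a h \<bullet> d = 0" if h: "h \<in> F" "a h \<bullet> y = \<beta> h" for h
      proof -
        have le: "a h \<bullet> p \<le> \<beta> h" "a h \<bullet> q \<le> \<beta> h" using pq(1,2) h(1) by (auto simp: D)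
        have "(1 - l) * (\<beta> h - a h \<bullet> p) + l * (\<beta> h - a h \<bullet> q) = 0"
          using h(2) unfolding l(3) by (simp add: inner_add_right algebra_simps)
        moreover have "(1 - l) * (\<beta> h - a h \<bullet> p) \<ge> 0" "l * (\<beta> h - a h \<bullet> q) \<ge> 0" using l le by auto
        ultimately have "(1 - l) * (\<beta> h - a h \<bullet> p) = 0" "l * (\<beta> h - a h \<bullet> q) = 0" by linarith+
        then show ?thesis using l by (simp add: d_def inner_diff_right)
      qed
      have move: "\<exists>r>0. y + r *\<^sub>R e \<in> G"
        if e: "e \<notin> recession_cone D" "\<And>h. h \<in> F \<Longrightarrow> a h \<bullet> y = \<beta> h \<Longrightarrow> a h \<bullet> e = 0" for e
      proof -
        \<comment> \<open>A ratio test: \<open>J\<close> holds the constraints that moving along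
          \<open>e\<close> tightens, \<open>R h\<close> is the step at which \<open>h\<close>
          becomes active, and \<open>r\<close> is the first such step.\<close>
        define J where "J = {h \<in> F. a h \<bullet> e > 0}"
        define R where "R = (\<lambda>h. (\<beta> h - a h \<bullet> y) / (a h \<bullet> e))"
        define r where "r = Min (R ` J)"
        have "finite J" using F by (simp add: J_def)
        have "J \<noteq> {}"
        proof
          assume "J = {}"
          then have nonpos: "a h \<bullet> e \<le> 0" if "h \<in> F" for h using that by (force simp: J_def)
          then have "e \<in> recession_cone D" unfolding D by (rule mem_recession_cone_halfspaces)
          with e(1) show False by contradiction
        qed
        then have "r \<in> R ` J" unfolding r_def using \<open>finite J\<close> by (intro Min_in) auto
        then obtain h0 where h0: "h0 \<in> J" "r = R h0" by blast
        have slack: "a h \<bullet> y < \<beta> h" if "h \<in> J" for h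
          using less.prems e(2)[of h] that by (force simp: J_def D order_less_le)
        have "r > 0" using slack[OF h0(1)] h0 by (simp add: R_def J_def)
        have r_le: "r * (a h \<bullet> e) \<le> \<beta> h - a h \<bullet> y" if "h \<in> J" for h
        proof -
          have "r \<le> R h" using that \<open>finite J\<close> by (simp add: r_def)
          then show ?thesis using that by (simp add: R_def J_def pos_le_divide_eq)
        qed
        have le: "a h \<bullet> (y + r *\<^sub>R e) \<le> \<beta> h" if h: "h \<in> F" for h
        proof (cases "h \<in> J")
          case True
          then show ?thesis using r_le[OF True] by (simp add: inner_add_right)
        next
          case False
          then have "a h \<bullet> e \<le> 0" using h by (simp add: J_def)
          then have "r * (a h \<bullet> e) \<le> 0" using \<open>r > 0\<close> by (simp add: mult_nonneg_nonpos)
          moreover have "a h \<bullet> y \<le> \<beta> h" using less.prems h by (simp add: D)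
          ultimately show ?thesis by (simp add: inner_add_right)
        qed
        have "a h0 \<bullet> (y + r *\<^sub>R e) = \<beta> h0"
          using h0 by (simp add: inner_add_right R_def J_def)
        moreover have "inactive (y + r *\<^sub>R e) \<subseteq> inactive y"
        proof
          fix h assume "h \<in> inactive (y + r *\<^sub>R e)"
          then have h: "h \<in> F" "a h \<bullet> (y + r *\<^sub>R e) < \<beta> h" by (auto simp: inactive_def)
          have "a h \<bullet> y \<noteq> \<beta> h" using e(2)[OF h(1)] h(2) by (auto simp: inner_add_right)
          moreover have "a h \<bullet> y \<le> \<beta> h" using less.prems h(1) by (simp add: D)
          ultimately show "h \<in> inactive y" using h(1) by (simp add: inactive_def)
        qed
        moreover have "h0 \<in> inactive y" using slack[OF h0(1)] h0(1) by (simp add: inactive_def J_def)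
        ultimately have "inactive (y + r *\<^sub>R e) \<subset> inactive y" by (force simp: inactive_def)
        then have "card (inactive (y + r *\<^sub>R e)) < card (inactive y)"
          using F by (intro psubset_card_mono) (simp_all add: inactive_def)
        then have "y + r *\<^sub>R e \<in> G" using le by (intro less.hyps) (auto simp: D)
        with \<open>r > 0\<close> show ?thesis by blast
      qed
      have one_sided: "y \<in> G" if "e \<in> recession_cone D" "r > 0" "y + r *\<^sub>R (- e) \<in> G" for e r
      proof -
        have "r *\<^sub>R e \<in> recession_cone D" using rc that by simp
        from G_add[OF that(3) this] show ?thesis by simp
      qed
      have active': "a h \<bullet> (- d) = 0" if "h \<in> F" "a h \<bullet> y = \<beta> h" for h
        using active[OF that] by simp
      consider "d \<in> recession_cone D" | "- d \<in> recession_cone D"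
        | "d \<notin> recession_cone D" "- d \<notin> recession_cone D" by blast
      then show ?thesis
      proof cases
        case 1
        \<comment> \<open>Pointedness excludes a full line, so the opposite direction must hit a
          constraint; from the point reached there, \<open>y\<close> is regained along the recession
          direction.\<close>
        have "- d \<notin> recession_cone D"
          using 1 pointed \<open>d \<noteq> 0\<close> unfolding pointed_def by force
        then obtain r where "r > 0" "y + r *\<^sub>R (- d) \<in> G" using move[OF _ active'] by blast
        with 1 show ?thesis by (rule one_sided)
      next
        case 2
        have "d \<notin> recession_cone D"
          using 2 pointed \<open>d \<noteq> 0\<close> unfolding pointed_def by force
        then obtain r where "r > 0" "y + r *\<^sub>R d \<in> G" using move[OF _ active] by blast
        with 2 show ?thesis using one_sided[of "- d" r] by simp
      next
        case 3
        obtain r where r: "r > 0" "y + r *\<^sub>R d \<in> G" using move[OF 3(1) active] by blast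
        obtain s where s: "s > 0" "y + s *\<^sub>R (- d) \<in> G" using move[OF 3(2) active'] by blast
        \<comment> \<open>These weights are chosen so that the displacements \<open>r\<close> along
          \<open>d\<close> and \<open>s\<close> along \<open>- d\<close> cancel.\<close>
        have "s / (r + s) + r / (r + s) = 1"
          using r(1) s(1) by (simp add: add.commute flip: add_divide_distrib)
        then have "(s / (r + s)) *\<^sub>R (y + r *\<^sub>R d) + (r / (r + s)) *\<^sub>R (y + s *\<^sub>R (- d)) \<in> G"
          using r s by (intro convexD[OF \<open>convex G\<close>]) auto
        also have "(s / (r + s)) *\<^sub>R (y + r *\<^sub>R d) + (r / (r + s)) *\<^sub>R (y + s *\<^sub>R (- d))
            = (s / (r + s) + r / (r + s)) *\<^sub>R y"
          unfolding scaleR_left_distrib by (simp add: scaleR_right_diff_distrib scaleR_right_distrib mult.commute)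
        finally show ?thesis using \<open>s / (r + s) + r / (r + s) = 1\<close> by simp
      qed
    qed
  qed
  then show ?thesis unfolding G_def by blast
qed

section \<open>The Benson-type algorithm\<close>

lemma transpose_mult_inner: "(transpose M *v w) \<bullet> x = w \<bullet> (M *v x)" for M :: "real^'n^'m"
  by (metis dot_lmul_matrix transpose_matrix_vector)

lemma inner_mono_nonneg:
  fixes u x y :: "real^'m"
  assumes "0 \<le> u" and "x \<le> y"
  shows "u \<bullet> x \<le> u \<bullet> y"
  using assms by (auto simp: inner_vec_def less_eq_vec_def intro!: sum_mono mult_left_mono)

text \<open>The objective \<open>f\<close> is left out: the cuts and their finiteness depend only on
  the linear data. Quasi-concavity and monotonicity enter only in
  \<open>returned_point_is_minimizer\<close>.\<close>

locale benson_lp =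
  fixes P :: "real^'n^'q" and A :: "real^'n^'m" and b :: "real^'m"
    and Y :: "real^'o^'q" and Z :: "real^'p^'q" and c :: "real^'q"
    and S :: "(real^'n) set" and C :: "(real^'q) set"
  assumes S: "S = {x. b \<le> A *v x}" and S_nonempty: "S \<noteq> {}"
    and C_Y: "C = {Y *v l | l. l \<ge> 0}" and C_Z: "C = {y. transpose Z *v y \<ge> 0}"
    and C_pointed: "pointed C"
    and recession_image: "recession_cone ((*v) P ` S) \<subseteq> C"
    and c_interior: "c \<in> interior C"
begin

section \<open>The ordering cone and its interior point\<close>

lemma mem_C: "y \<in> C \<longleftrightarrow> (\<forall>j. (transpose Z $ j) \<bullet> y \<ge> 0)"
  by (simp only: C_Z less_eq_vec_def mem_Collect_eq zero_index matrix_vector_mul_component)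

lemma C_add: "y \<in> C \<Longrightarrow> y' \<in> C \<Longrightarrow> y + y' \<in> C"
  by (simp add: mem_C inner_add_right del: transpose_matrix_vector)

lemma C_scale: "y \<in> C \<Longrightarrow> r \<ge> 0 \<Longrightarrow> r *\<^sub>R y \<in> C"
  by (simp add: mem_C)

lemma C_zero: "0 \<in> C"
  by (simp add: mem_C)

text \<open>Otherwise pointedness gives \<open>c = 0\<close>, so a ball around the origin lies in
  \<open>C\<close>, and it contains a nonzero vector together with its negative.\<close>

lemma minus_c_notin_C: "- c \<notin> C"
proof
  assume "- c \<in> C"
  moreover have "c \<in> C" using c_interior interior_subset by blast
  ultimately have "c = 0" using C_pointed unfolding pointed_def by force
  with c_interior obtain e where e: "e > 0" "ball 0 e \<subseteq> C" by (auto simp: mem_interior)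
  \<comment> \<open>Any coordinate direction serves; \<open>undefined\<close> is just some
    index.\<close>
  define y where "y = (e / 2) *\<^sub>R (axis undefined 1 :: real^'q)"
  have "norm y < e" using e(1) by (simp add: y_def norm_axis_1)
  then have "y \<in> C" "- y \<in> C" using e(2) by auto
  then have "y = 0" using C_pointed unfolding pointed_def by force
  with e(1) show False by (simp add: y_def axis_eq_0_iff)
qed

text \<open>A small multiple \<open>s\<close> of \<open>q\<close> keeps
  \<open>c + s *\<^sub>R q\<close> in a ball around \<open>c\<close> inside \<open>C\<close>;
  scaling by \<open>1 / s\<close> gives the claim.\<close>

lemma C_absorbs: obtains r where "q + r *\<^sub>R c \<in> C"
proof -
  obtain e where e: "e > 0" "ball c e \<subseteq> C" using c_interior by (auto simp: mem_interior)
  \<comment> \<open>The added 1 keeps the denominator positive for \<open>q = 0\<close>.\<close>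
  define s where "s = (e / 2) / (norm q + 1)"
  have s: "s > 0" using e(1) by (simp add: s_def add_nonneg_pos)
  have "norm q + 1 > 0" by (simp add: add_nonneg_pos)
  then have "s * (norm q + 1) = e / 2" unfolding s_def by (intro nonzero_eq_divide_eq[THEN iffD1] refl) auto
  then have "s * norm q < e" using s e(1) by (simp add: distrib_left)
  then have "c + s *\<^sub>R q \<in> ball c e" using s by (simp add: dist_norm)
  then have "(1 / s) *\<^sub>R (c + s *\<^sub>R q) \<in> C" using e(2) s by (intro C_scale) auto
  then show ?thesis using s by (intro that[of "1 / s"]) (simp add: scaleR_right_distrib add.commute)
qed

section \<open>The scalar problems and their duality\<close>

lemma P2_feasible_iff: "P2_feasible A b P Z c t (x, z) \<longleftrightarrow> x \<in> S \<and> t + z *\<^sub>R c - P *v x \<in> C"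
proof -
  have "transpose Z *v (t + z *\<^sub>R c - P *v x) =
      transpose Z *v t + z *\<^sub>R (transpose Z *v c) - transpose Z *v (P *v x)"
    by (simp only: matrix_vector_mult_diff_distrib matrix_vector_right_distrib matrix_vector_mult_scaleR)
  then show ?thesis unfolding P2_feasible_def C_Z S by (simp del: transpose_matrix_vector)
qed

text \<open>The columns of \<open>Y\<close> generate \<open>C\<close>, so the sign condition on
  \<open>w\<close> says that \<open>w\<close> lies in the dual cone. The columns themselves are
  reached through the unit vectors.\<close>

lemma D2_feasible_iff: "D2_feasible A P Y c (u, w) \<longleftrightarrow>
    transpose A *v u = transpose P *v w \<and> w \<bullet> c = 1 \<and> (\<forall>k\<in>C. w \<bullet> k \<ge> 0) \<and> 0 \<le> u"
proof -
  have "0 \<le> transpose Y *v w \<longleftrightarrow> (\<forall>k\<in>C. w \<bullet> k \<ge> 0)"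
  proof
    assume nonneg: "0 \<le> transpose Y *v w"
    show "\<forall>k\<in>C. w \<bullet> k \<ge> 0"
    proof
      fix k assume "k \<in> C"
      then obtain l where "l \<ge> 0" "k = Y *v l" unfolding C_Y by blast
      then show "w \<bullet> k \<ge> 0"
        using inner_mono_nonneg[OF _ nonneg, of l] transpose_mult_inner[of Y w l]
        by (simp add: inner_commute del: transpose_matrix_vector)
    qed
  next
    assume nonneg: "\<forall>k\<in>C. w \<bullet> k \<ge> 0"
    have "0 \<le> (transpose Y *v w) $ k" for k
    proof -
      have "Y *v axis k 1 \<in> C" unfolding C_Y by (auto simp: less_eq_vec_def axis_def)
      then have "(transpose Y *v w) \<bullet> axis k 1 \<ge> 0" using nonneg by (simp only: transpose_mult_inner)
      then show ?thesis by (simp add: inner_axis)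
    qed
    then show "0 \<le> transpose Y *v w" by (simp add: less_eq_vec_def)
  qed
  then show ?thesis unfolding D2_feasible_def by (auto simp: inner_commute)
qed

lemma D2_feasible_valid:
  assumes "D2_feasible A P Y c (u, w)" and "x \<in> S" and "y - P *v x \<in> C"
  shows "b \<bullet> u \<le> w \<bullet> y"
proof -
  have D: "transpose A *v u = transpose P *v w" "\<forall>k\<in>C. w \<bullet> k \<ge> 0" "0 \<le> u"
    using assms(1) unfolding D2_feasible_iff by auto
  have "b \<bullet> u \<le> u \<bullet> (A *v x)"
    using inner_mono_nonneg[OF D(3), of b "A *v x"] assms(2) by (simp add: S inner_commute)
  also have "\<dots> = (transpose A *v u) \<bullet> x" by (simp only: transpose_mult_inner)
  also have "\<dots> = w \<bullet> (P *v x)" by (simp only: D(1) transpose_mult_inner)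
  also have "\<dots> \<le> w \<bullet> y" using D(2) assms(3) by (auto simp: inner_diff_right)
  finally show ?thesis .
qed

text \<open>The valid inequality is evaluated at \<open>t + z *\<^sub>R c\<close>, where the
  normalization of \<open>w\<close> makes \<open>z\<close> appear with coefficient 1.\<close>

lemma weak_duality:
  assumes "P2_feasible A b P Z c t (x, z)" and "D2_feasible A P Y c (u, w)"
  shows "b \<bullet> u - t \<bullet> w \<le> z"
proof -
  have "b \<bullet> u \<le> w \<bullet> (t + z *\<^sub>R c)"
    using assms D2_feasible_valid[of u w x] by (simp add: P2_feasible_iff)
  then show ?thesis
    using assms(2) by (simp add: D2_feasible_iff inner_add_right inner_commute)
qed

lemma P2_D2_strong_duality:
  obtains x z u w where "P2_feasible A b P Z c t (x, z)" "D2_feasible A P Y c (u, w)"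
    "z = b \<bullet> u - t \<bullet> w"
proof -
  define \<zeta> where "\<zeta> = (\<lambda>j. transpose Z $ j)"
  \<comment> \<open>The rows of \<open>P2\<close> in the variables \<open>(x, z)\<close>:
    \<open>Inl\<close> indexes the rows of \<open>A\<close>, \<open>Inr\<close> the cone
    inequalities given by \<open>Z\<close>. The objective is the vector
    \<open>(0, 1)\<close>.\<close>
  define a where "a = case_sum (\<lambda>i. (A $ i, 0)) (\<lambda>j. (- (transpose P *v \<zeta> j), \<zeta> j \<bullet> c))"
  define \<beta> where "\<beta> = case_sum (\<lambda>i. b $ i) (\<lambda>j. - (\<zeta> j \<bullet> t))"
  have mem_C: "y \<in> C \<longleftrightarrow> (\<forall>j. \<zeta> j \<bullet> y \<ge> 0)" for y by (simp only: mem_C \<zeta>_def)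
  have a_Inl: "a (Inl i) \<bullet> (x, z) = (A *v x) $ i" for i x z
    by (simp add: a_def matrix_vector_mul_component)
  have a_Inr: "a (Inr j) \<bullet> (x, z) = \<zeta> j \<bullet> (z *\<^sub>R c - P *v x)" for j x z
    by (simp add: a_def transpose_mult_inner inner_diff_right del: transpose_matrix_vector)
  have feasible: "(\<forall>i\<in>UNIV. a i \<bullet> (x, z) \<ge> \<beta> i) \<longleftrightarrow> P2_feasible A b P Z c t (x, z)" for x z
  proof -
    have "(\<forall>i\<in>UNIV. a i \<bullet> (x, z) \<ge> \<beta> i) \<longleftrightarrow>
        (\<forall>i. a (Inl i) \<bullet> (x, z) \<ge> \<beta> (Inl i)) \<and> (\<forall>j. a (Inr j) \<bullet> (x, z) \<ge> \<beta> (Inr j))"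
      by (metis UNIV_I sumE)
    also have "(\<forall>i. a (Inl i) \<bullet> (x, z) \<ge> \<beta> (Inl i)) \<longleftrightarrow> x \<in> S"
      by (simp add: a_Inl \<beta>_def S less_eq_vec_def)
    also have "(\<forall>j. a (Inr j) \<bullet> (x, z) \<ge> \<beta> (Inr j)) \<longleftrightarrow> t + z *\<^sub>R c - P *v x \<in> C"
      unfolding mem_C a_Inr by (auto simp: \<beta>_def inner_diff_right inner_add_right algebra_simps)
    finally show ?thesis by (simp add: P2_feasible_iff)
  qed
  obtain x0 where x0: "x0 \<in> S" using S_nonempty by blast
  \<comment> \<open>Moving far enough along \<open>c\<close> makes any \<open>x0\<close> in
    \<open>S\<close> feasible.\<close>
  obtain z0 where "t - P *v x0 + z0 *\<^sub>R c \<in> C" by (rule C_absorbs)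
  then have "P2_feasible A b P Z c t (x0, z0)" using x0 by (simp add: P2_feasible_iff algebra_simps)
  then have x0_feasible: "\<forall>i\<in>UNIV. a i \<bullet> (x0, z0) \<ge> \<beta> i" by (simp only: feasible)
  \<comment> \<open>A direction that decreases \<open>z\<close> would have
    \<open>s *\<^sub>R c - P *v d\<close> in \<open>C\<close> with \<open>s < 0\<close>. Since
    \<open>d\<close> is a recession direction of \<open>S\<close>, also \<open>P *v d\<close> lies
    in \<open>C\<close>; the sum puts \<open>- c\<close> into \<open>C\<close>.\<close>
  have bounded: "(0, 1) \<bullet> p \<ge> 0" if p: "\<And>i. i \<in> UNIV \<Longrightarrow> a i \<bullet> p \<ge> 0" for p
  proof (rule ccontr)
    obtain d s where [simp]: "p = (d, s)" by fastforce
    assume "\<not> ?thesis"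
    then have s: "s < 0" by simp
    have Ad: "0 \<le> A *v d" using p[of "Inl _"] by (simp add: a_Inl less_eq_vec_def)
    have "s *\<^sub>R c - P *v d \<in> C" using p[of "Inr _"] by (simp add: a_Inr mem_C)
    moreover have "P *v d \<in> C"
    proof (rule subsetD[OF recession_image], unfold recession_cone_def, safe)
      fix x and r :: real assume "x \<in> S" "r \<ge> 0"
      then have "x + r *\<^sub>R d \<in> S"
        using Ad by (auto simp: S less_eq_vec_def matrix_vector_right_distrib matrix_vector_mult_scaleR
            intro: add_increasing2)
      moreover have "P *v x + r *\<^sub>R (P *v d) = P *v (x + r *\<^sub>R d)"
        by (simp add: matrix_vector_right_distrib matrix_vector_mult_scaleR)
      ultimately show "P *v x + r *\<^sub>R (P *v d) \<in> (*v) P ` S" by blast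
    qed
    ultimately have "s *\<^sub>R c \<in> C" using C_add by fastforce
    then have "(1 / (- s)) *\<^sub>R (s *\<^sub>R c) \<in> C" by (rule C_scale) (use s in simp)
    moreover have "(1 / (- s)) *\<^sub>R (s *\<^sub>R c) = - c" using s by simp
    ultimately show False using minus_c_notin_C by simp
  qed
  obtain p v where pv: "\<forall>i\<in>UNIV. a i \<bullet> p \<ge> \<beta> i" "\<forall>i. v i \<ge> 0"
    "(\<Sum>i\<in>UNIV. v i *\<^sub>R a i) = (0, 1)" "(0, 1) \<bullet> p = (\<Sum>i\<in>UNIV. v i * \<beta> i)"
    by (rule lp_strong_duality[OF finite x0_feasible bounded])
  obtain x z where p: "p = (x, z)" by fastforce
  have sum_UNIV: "(\<Sum>i\<in>UNIV. h i) = (\<Sum>i\<in>UNIV. h (Inl i)) + (\<Sum>j\<in>UNIV. h (Inr j))"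
    for h :: "'m + 'p \<Rightarrow> 'v::comm_monoid_add"
    using sum.Plus[of "UNIV :: 'm set" "UNIV :: 'p set" h] by simp
  define u where "u = (\<chi> i. v (Inl i))"
  \<comment> \<open>As a nonnegative combination of the inequalities defining \<open>C\<close>, this
    \<open>w\<close> is nonnegative on \<open>C\<close>. The two components of the multiplier
    equation are the two equality constraints of the dual.\<close>
  define w where "w = (\<Sum>j\<in>UNIV. v (Inr j) *\<^sub>R \<zeta> j)"
  have A_u: "transpose A *v u = (\<Sum>i\<in>UNIV. v (Inl i) *\<^sub>R A $ i)"
    by (simp add: vec_eq_iff u_def vector_matrix_mult_def mult.commute)
  have P_w: "transpose P *v w = (\<Sum>j\<in>UNIV. v (Inr j) *\<^sub>R (transpose P *v \<zeta> j))"
    unfolding w_def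
    by (simp add: linear_sum[OF matrix_vector_mul_linear] matrix_vector_mult_scaleR del: transpose_matrix_vector)
  have "(\<Sum>i\<in>UNIV. v (Inl i) *\<^sub>R A $ i) - (\<Sum>j\<in>UNIV. v (Inr j) *\<^sub>R (transpose P *v \<zeta> j)) = 0"
    and wc: "(\<Sum>j\<in>UNIV. v (Inr j) * (\<zeta> j \<bullet> c)) = 1"
    using pv(3) unfolding sum_UNIV
    by (auto simp: a_def prod_eq_iff fst_sum snd_sum sum_negf simp del: transpose_matrix_vector)
  then have "transpose A *v u = transpose P *v w" unfolding A_u P_w by simp
  moreover have "w \<bullet> c = 1" using wc by (simp add: w_def inner_sum_left)
  moreover have "w \<bullet> k \<ge> 0" if "k \<in> C" for k
    using that pv(2) by (simp add: w_def inner_sum_left mem_C sum_nonneg)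
  moreover have "0 \<le> u" using pv(2) by (simp add: u_def less_eq_vec_def)
  ultimately have "D2_feasible A P Y c (u, w)" by (simp add: D2_feasible_iff)
  moreover have "z = b \<bullet> u - t \<bullet> w"
    using pv(4) unfolding sum_UNIV
    by (simp add: p \<beta>_def u_def w_def inner_vec_def[of b] inner_sum_right sum_negf mult.commute inner_commute)
  moreover have "P2_feasible A b P Z c t (x, z)" using pv(1) feasible[of x z] by (simp add: p)
  ultimately show ?thesis using that by blast
qed

lemma P2_D2_solvable:
  "(\<exists>x z. P2_optimal A b P Z c t (x, z)) \<and> (\<exists>u w. D2_optimal A b P Y c t (u, w))"
proof -
  obtain x z u w where opt: "P2_feasible A b P Z c t (x, z)" "D2_feasible A P Y c (u, w)"
    "z = b \<bullet> u - t \<bullet> w" by (rule P2_D2_strong_duality)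
  have "P2_optimal A b P Z c t (x, z)"
    unfolding P2_optimal_def is_arg_min_def using opt(1,3) weak_duality[OF _ opt(2)]
    by (auto simp: not_less)
  moreover have "D2_optimal A b P Y c t (u, w)"
    unfolding D2_optimal_def is_arg_max_def using opt(2,3) weak_duality[OF opt(1)]
    by (auto simp: not_less)
  ultimately show ?thesis by blast
qed

text \<open>The algorithm may pick any optimal solutions, so the pair from
  \<open>P2_D2_strong_duality\<close> serves only to sandwich both values.\<close>

lemma optimal_values_agree:
  assumes "P2_optimal A b P Z c t (x, z)" and "D2_optimal A b P Y c t (u, w)"
  shows "z = b \<bullet> u - t \<bullet> w"
proof -
  obtain x' z' u' w' where opt: "P2_feasible A b P Z c t (x', z')" "D2_feasible A P Y c (u', w')"
    "z' = b \<bullet> u' - t \<bullet> w'" by (rule P2_D2_strong_duality)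
  have "z \<le> z'" using assms(1) opt(1) unfolding P2_optimal_def is_arg_min_def by fastforce
  moreover have "b \<bullet> u' - t \<bullet> w' \<le> b \<bullet> u - t \<bullet> w"
    using assms(2) opt(2) unfolding D2_optimal_def is_arg_max_def by fastforce
  moreover have "b \<bullet> u - t \<bullet> w \<le> z"
    using assms by (intro weak_duality) (auto simp: P2_optimal_def D2_optimal_def is_arg_min_def is_arg_max_def)
  ultimately show ?thesis using opt(3) by linarith
qed

section \<open>Outer approximations and correctness at termination\<close>

lemma cut_contains_upper_image:
  assumes "D2_feasible A P Y c (u, w)" and "(*v) P ` S + C \<subseteq> D"
  shows "(*v) P ` S + C \<subseteq> D \<inter> {y. w \<bullet> y \<ge> b \<bullet> u}"
proof
  fix y assume y: "y \<in> (*v) P ` S + C"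
  then obtain x k where "x \<in> S" "k \<in> C" "y = P *v x + k" by (auto simp: set_plus_def)
  then have "b \<bullet> u \<le> w \<bullet> y" using assms(1) by (intro D2_feasible_valid) auto
  then show "y \<in> D \<inter> {y. w \<bullet> y \<ge> b \<bullet> u}" using assms(2) y by auto
qed

text \<open>The loop invariant. The recession cone is controlled by an inclusion, which
  \<open>recession_cone_Int_subset\<close> carries through every cut.\<close>

definition outer_approximation :: "(real^'q) set \<Rightarrow> bool" where
  "outer_approximation D \<longleftrightarrow>
     polyhedron D \<and> (*v) P ` S + C \<subseteq> D \<and> recession_cone D \<subseteq> C"

lemma image_subset_upper_image: "x \<in> S \<Longrightarrow> P *v x \<in> (*v) P ` S + C"
  using set_plus_intro[OF _ C_zero, of "P *v x" "(*v) P ` S"] by simp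

lemma outer_approximation_cut:
  assumes "outer_approximation D" and "D2_feasible A P Y c (u, w)"
  shows "outer_approximation (D \<inter> {y. w \<bullet> y \<ge> b \<bullet> u})"
proof -
  have "(*v) P ` S + C \<subseteq> D \<inter> {y. w \<bullet> y \<ge> b \<bullet> u}"
    using assms by (intro cut_contains_upper_image) (auto simp: outer_approximation_def)
  moreover from this have "D \<inter> {y. w \<bullet> y \<ge> b \<bullet> u} \<noteq> {}"
    using S_nonempty image_subset_upper_image by blast
  ultimately show ?thesis
    using assms(1) recession_cone_Int_subset[of D "{y. w \<bullet> y \<ge> b \<bullet> u}"]
    by (auto simp: outer_approximation_def intro: polyhedron_halfspace_ge)
qed

lemma outer_approximation_decomposition:
  assumes "outer_approximation D" and "y \<in> D"
  obtains v where "v \<in> convex hull (vertices D)" "y - v \<in> C"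
proof -
  have "recession_cone D \<subseteq> C" using assms(1) by (simp add: outer_approximation_def)
  moreover have "0 \<in> recession_cone D" by (intro convex_cone_contains_0 convex_cone_recession_cone)
  ultimately have "pointed (recession_cone D)"
    using C_pointed unfolding pointed_def by (intro equalityI subsetI) auto
  then have "y \<in> convex hull (vertices D) + recession_cone D"
    using polyhedron_subset_vertices_plus_recession_cone[of D] assms
    by (auto simp: outer_approximation_def)
  then obtain v k where "y = v + k" "v \<in> convex hull (vertices D)" "k \<in> recession_cone D"
    by (elim set_plus_elim)
  then show ?thesis using assms(1) by (intro that[of v]) (auto simp: outer_approximation_def)
qed

lemma executable_if_outer_approximation:
  assumes "outer_approximation D"
  shows "benson_executable A b P Y Z f c D"
proof -
  have "polyhedron D" using assms by (simp add: outer_approximation_def)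
  then have fin: "finite (vertices D)" by (simp add: vertices_def finite_polyhedron_extreme_points)
  obtain x where "x \<in> S" using S_nonempty by blast
  then have "P *v x \<in> D" using image_subset_upper_image assms by (auto simp: outer_approximation_def)
  then obtain v where "v \<in> convex hull (vertices D)"
    using outer_approximation_decomposition[OF assms] by blast
  \<comment> \<open>The hull in the decomposition of an image point is inhabited, so there is a
    vertex to select.\<close>
  then have "vertices D \<noteq> {}" by auto
  then have "\<exists>t. selectable f D t"
    unfolding selectable_def using ex_is_arg_min_if_finite[OF fin] by simp
  with \<open>polyhedron D\<close> fin P2_D2_solvable show ?thesis by (simp add: benson_executable_def)
qed

text \<open>With \<open>k = t - P *v x\<close>, the point \<open>t\<close> is the midpoint of
  \<open>P *v x\<close> and \<open>P *v x + 2 *\<^sub>R k\<close>, both in \<open>D\<close>;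
  extremality forces \<open>k = 0\<close>.\<close>

lemma extreme_point_of_plus_cone:
  assumes "t extreme_point_of D" "(*v) P ` S + C \<subseteq> D" "x \<in> S" "t - P *v x \<in> C"
  shows "t = P *v x"
proof (rule ccontr)
  assume "t \<noteq> P *v x"
  define k where "k = t - P *v x"
  have "P *v x \<in> D" using image_subset_upper_image assms(2,3) by auto
  moreover have "P *v x + 2 *\<^sub>R k \<in> D"
  proof -
    have "2 *\<^sub>R k \<in> C" using assms(4) by (intro C_scale) (auto simp: k_def)
    then have "P *v x + 2 *\<^sub>R k \<in> (*v) P ` S + C" using assms(3) by (intro set_plus_intro) auto
    then show ?thesis using assms(2) by auto
  qed
  moreover have "t \<in> open_segment (P *v x) (P *v x + 2 *\<^sub>R k)"
  proof -
    have "P *v x + (P *v x + 2 *\<^sub>R k) = 2 *\<^sub>R t" by (simp add: k_def scaleR_2)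
    then have "midpoint (P *v x) (P *v x + 2 *\<^sub>R k) = t" by (simp add: midpoint_def)
    moreover have "k \<noteq> 0" using \<open>t \<noteq> P *v x\<close> by (simp add: k_def)
    ultimately show ?thesis using midpoint_in_open_segment[of "P *v x" "P *v x + 2 *\<^sub>R k"] by simp
  qed
  ultimately show False using assms(1) unfolding extreme_point_of_def by blast
qed

lemma returned_point_is_minimizer:
  assumes D: "outer_approximation D" and t: "selectable f D t"
    and opt: "P2_optimal A b P Z c t (x, z)" "\<not> z > 0"
    and "quasi_concave f" and mono: "cone_monotone_on (minkowski_diff ((*v) P ` S) C) C f"
  shows "is_arg_min (\<lambda>x. f (P *v x)) (\<lambda>x. b \<le> A *v x) x"
proof -
  have x: "x \<in> S" "t + z *\<^sub>R c - P *v x \<in> C"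
    using opt(1) by (auto simp: P2_optimal_def is_arg_min_def P2_feasible_iff)
  have "c \<in> C" using c_interior interior_subset by blast
  then have "(- z) *\<^sub>R c \<in> C" using opt(2) by (intro C_scale) auto
  with x(2) have "t - P *v x \<in> C" using C_add[of "t + z *\<^sub>R c - P *v x" "(- z) *\<^sub>R c"] by simp
  moreover have "t extreme_point_of D" using t by (simp add: selectable_def is_arg_min_def vertices_def)
  ultimately have t_eq: "t = P *v x"
    using D x(1) by (intro extreme_point_of_plus_cone[of t D]) (auto simp: outer_approximation_def)
  have "f t \<le> f (P *v x')" if x': "x' \<in> S" for x'
  proof -
    have "P *v x' \<in> D" using image_subset_upper_image[OF x'] D by (auto simp: outer_approximation_def)
    then obtain v where v: "v \<in> convex hull (vertices D)" "P *v x' - v \<in> C"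
      using outer_approximation_decomposition[OF D] by blast
    have "vertices D \<subseteq> {y. f y \<ge> f t}"
      using t by (auto simp: selectable_def is_arg_min_def not_less)
    then have "convex hull (vertices D) \<subseteq> {y. f y \<ge> f t}"
      using assms(5) by (intro hull_minimal) (auto simp: quasi_concave_def)
    then have "f t \<le> f v" using v(1) by auto
    also have "f v \<le> f (P *v x')"
    proof -
      \<comment> \<open>The point \<open>v\<close> may lie outside the upper image, but it is an
        image point minus an element of \<open>C\<close>. This is where monotonicity on the
        difference set is used.\<close>
      have "v \<in> minkowski_diff ((*v) P ` S) C"
        unfolding minkowski_diff_def using x' v(2) by (force intro: exI[of _ "P *v x' - v"])
      moreover have "P *v x' \<in> minkowski_diff ((*v) P ` S) C"
        unfolding minkowski_diff_def using x' C_zero by force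
      ultimately show ?thesis using mono v(2) unfolding cone_monotone_on_def by blast
    qed
    finally show ?thesis .
  qed
  then show ?thesis using x(1) t_eq unfolding is_arg_min_def S by (auto simp: not_less)
qed

lemma reachable_outer_approximation:
  assumes "(benson_step A b P Y Z f c)\<^sup>*\<^sup>* (Running D) s" and "outer_approximation D"
    and "s = Running E"
  shows "outer_approximation E"
  using assms
proof (induction arbitrary: E rule: rtranclp_induct)
  case base
  then show ?case by simp
next
  case (step s s')
  from step.hyps(2) show ?case
  proof cases
    case (cut D' t x z u w)
    then have "D2_feasible A P Y c (u, w)" by (simp add: D2_optimal_def is_arg_max_def)
    moreover have "outer_approximation D'" using step.IH step.prems(1) cut(1) by blast
    moreover have "E = D' \<inter> {y. w \<bullet> y \<ge> b \<bullet> u}" using cut(2) step.prems(2) by simp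
    ultimately show ?thesis by (simp only: outer_approximation_cut)
  next
    case stop
    with step.prems show ?thesis by simp
  qed
qed

section \<open>Finiteness of the run\<close>

text \<open>
  Every cut supports the lifted image below in a face. If a later cut, at \<open>t\<close> with value \<open>z\<close>, had
  the same face, then \<open>t + z *\<^sub>R c\<close> would satisfy the earlier inequality with equality, which
  contradicts that \<open>t\<close> satisfies it and \<open>w \<bullet> c = 1\<close>, \<open>z > 0\<close>. Working in the lifted space makes the
  finiteness of faces available without showing that the upper image itself is polyhedral.
\<close>

definition lifted_image :: "((real^'n) \<times> (real^'q)) set" where
  "lifted_image = {(x, y). x \<in> S \<and> y - P *v x \<in> C}"

lemma polyhedron_lifted_image: "polyhedron lifted_image"
proof -
  let ?F = "range (\<lambda>i. {p. (A $ i, 0::real^'q) \<bullet> p \<ge> b $ i})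
    \<union> range (\<lambda>j. {p. (- (transpose P *v transpose Z $ j), transpose Z $ j) \<bullet> p \<ge> 0})"
  have "x \<in> S \<longleftrightarrow> (\<forall>i. b $ i \<le> A $ i \<bullet> x)" for x
    by (simp add: S less_eq_vec_def matrix_vector_mul_component)
  then have "lifted_image = \<Inter> ?F"
    unfolding lifted_image_def mem_C
    by (auto simp: inner_diff_right transpose_mult_inner ball_Un simp del: transpose_matrix_vector)
  moreover have "polyhedron (\<Inter> ?F)"
    by (rule polyhedron_Inter) (auto intro: polyhedron_halfspace_ge)
  ultimately show ?thesis by simp
qed

lemma no_infinite_run:
  assumes run: "\<And>k::nat. benson_step A b P Y Z f c (\<sigma> k) (\<sigma> (Suc k))"
  shows False
proof -
  \<comment> \<open>A returned state has no successor, so an infinite run consists of cuts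
    only.\<close>
  have "\<exists>E. \<sigma> k = Running E" for k using run[of k] by (auto elim: benson_step.cases)
  then obtain E where E: "\<And>k. \<sigma> k = Running (E k)" by metis
  have "\<exists>t x z u w. P2_optimal A b P Z c t (x, z) \<and> D2_optimal A b P Y c t (u, w) \<and> z > 0 \<and>
      t \<in> E k \<and> E (Suc k) = E k \<inter> {y. w \<bullet> y \<ge> b \<bullet> u}" for k
    using run[of k] unfolding E
    by cases (force simp: selectable_def is_arg_min_def vertices_def extreme_point_of_def)
  then obtain t x z u w where step: "\<And>k. P2_optimal A b P Z c (t k) (x k, z k)"
    "\<And>k. D2_optimal A b P Y c (t k) (u k, w k)" "\<And>k. z k > 0" "\<And>k. t k \<in> E k"
    "\<And>k. E (Suc k) = E k \<inter> {y. w k \<bullet> y \<ge> b \<bullet> u k}"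
    by metis
  have P2: "x k \<in> S" "t k + z k *\<^sub>R c - P *v x k \<in> C" for k
    using step(1)[of k] by (auto simp: P2_optimal_def is_arg_min_def P2_feasible_iff)
  have D2: "D2_feasible A P Y c (u k, w k)" for k
    using step(2)[of k] by (auto simp: D2_optimal_def is_arg_max_def)
  then have wc: "w k \<bullet> c = 1" for k by (simp add: D2_feasible_iff)
  define \<Phi> where "\<Phi> = (\<lambda>k. lifted_image \<inter> {p. (0, w k) \<bullet> p = b \<bullet> u k})"
  have face: "\<Phi> k face_of lifted_image" for k
    unfolding \<Phi>_def
  proof (rule face_of_Int_supporting_hyperplane_ge)
    show "convex lifted_image" using polyhedron_lifted_image by (rule polyhedron_imp_convex)
    show "(0, w k) \<bullet> p \<ge> b \<bullet> u k" if "p \<in> lifted_image" for p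
      using that D2_feasible_valid[OF D2] by (auto simp: lifted_image_def)
  qed
  have "finite (range \<Phi>)"
  proof (rule finite_subset)
    show "range \<Phi> \<subseteq> {F. F face_of lifted_image}" using face by blast
    show "finite {F. F face_of lifted_image}" using polyhedron_lifted_image by (rule finite_polyhedron_faces)
  qed
  moreover have "inj \<Phi>"
  proof (rule linorder_injI)
    fix j k :: nat assume "j < k"
    \<comment> \<open>The approximations shrink, so the later vertex \<open>t k\<close> already
      satisfies cut \<open>j\<close>.\<close>
    have "E k \<subseteq> E (Suc j)"
    proof (rule decseqD[of E])
      show "decseq E" by (rule decseq_SucI) (simp only: step(5) Int_lower1)
      show "Suc j \<le> k" using \<open>j < k\<close> by simp
    qed
    then have "t k \<in> E (Suc j)" using step(4)[of k] by blast
    then have "w j \<bullet> t k \<ge> b \<bullet> u j" unfolding step(5) by simp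
    then have "w j \<bullet> (t k + z k *\<^sub>R c) > b \<bullet> u j" using wc[of j] step(3)[of k] by (simp add: inner_add_right)
    then have "(x k, t k + z k *\<^sub>R c) \<notin> \<Phi> j" by (simp add: \<Phi>_def)
    moreover have "w k \<bullet> (t k + z k *\<^sub>R c) = b \<bullet> u k"
      using optimal_values_agree[OF step(1,2), of k] wc[of k] by (simp add: inner_add_right inner_commute)
    then have "(x k, t k + z k *\<^sub>R c) \<in> \<Phi> k" using P2[of k] by (simp add: \<Phi>_def lifted_image_def)
    ultimately show "\<Phi> j \<noteq> \<Phi> k" by blast
  qed
  ultimately show False using finite_imageD infinite_UNIV_nat by blast
qed

end

theorem theorem9:
  fixes P :: "real^'n^'q" and A :: "real^'n^'m" and b :: "real^'m"
    and Y :: "real^'o^'q" and Z :: "real^'p^'q"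
    and f :: "real^'q \<Rightarrow> real" and c :: "real^'q"
    and S :: "(real^'n) set" and C D :: "(real^'q) set"
  assumes "S = {x. A *v x \<ge> b}" and "S \<noteq> {}"
    and "quasi_concave f"
    and "C = {Y *v l | l. l \<ge> 0}" and "C = {y. transpose Z *v y \<ge> 0}"
    and "pointed C" and "interior C \<noteq> {}"
    and "cone_monotone_on (minkowski_diff ((*v) P ` S) C) C f"
    and "recession_cone ((*v) P ` S) \<subseteq> C"
    and "c \<in> interior C"
    and "polyhedron D" and "(*v) P ` S + C \<subseteq> D" and "recession_cone D = C"
  shows
    "(\<forall>E. (benson_step A b P Y Z f c)\<^sup>*\<^sup>* (Running D) (Running E)
        \<longrightarrow> benson_executable A b P Y Z f c E) \<and>
     (\<nexists>\<sigma>. \<sigma> 0 = Running D \<and> (\<forall>k::nat. benson_step A b P Y Z f c (\<sigma> k) (\<sigma> (Suc k)))) \<and>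
     (\<forall>x. (benson_step A b P Y Z f c)\<^sup>*\<^sup>* (Running D) (Returned x)
        \<longrightarrow> is_arg_min (\<lambda>x. f (P *v x)) (\<lambda>x. A *v x \<ge> b) x)"
proof -
  interpret benson_lp P A b Y Z c S C
    by unfold_locales (rule assms)+
  have D: "outer_approximation D" using assms(11-13) by (simp add: outer_approximation_def)
  have reachable: "outer_approximation E"
    if "(benson_step A b P Y Z f c)\<^sup>*\<^sup>* (Running D) (Running E)" for E
    using reachable_outer_approximation[OF that D refl] .
  have "is_arg_min (\<lambda>x. f (P *v x)) (\<lambda>x. A *v x \<ge> b) x"
    if "(benson_step A b P Y Z f c)\<^sup>*\<^sup>* (Running D) (Returned x)" for x
    using that
  proof (cases rule: rtranclp.cases)
    \<comment> \<open>A run that returns \<open>x\<close> is not empty, and its last transition is a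
      \<open>stop\<close> from a reachable running state, where the invariant holds.\<close>
    case (rtrancl_into_rtrancl s)
    from rtrancl_into_rtrancl(2) show ?thesis
    proof cases
      case (stop E t z u w)
      with rtrancl_into_rtrancl(1) show ?thesis
        using assms(3,8) by (auto intro: returned_point_is_minimizer reachable)
    qed
  qed
  then show ?thesis using executable_if_outer_approximation reachable no_infinite_run by blast
qed

end
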